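(* For every variable $x\in V$, every command $c\in\mathcal C$ and every reflexive relation $g\subseteq\Sigma\times\Sigma$ such that $g=\mathsf E_xg$, $$(\mathbf{var}\,x\cdot c)\Cap\mathbf{guar}\,g=(\mathbf{var}\,x\cdot c\Cap\mathbf{guar}\,g).$$
   Context: Commands. $(\mathcal C,\le,\bigwedge,\bigsqcup,\bot,\top)$ is a complete distributive lattice (with arbitrary meet $\bigwedge$, binary meet $\sqcap$, arbitrary join $\bigsqcup$ and binary join $\sqcup$) whose elements are called commands. It has an associative sequential composition $;$ with identity $\mathbf{nil}$, monotone in both arguments, and an associative, commutative, idempotent, monotone weak conjunction $\Cap$. Iterations: $c^0=\mathbf{nil}$, $c^{i+1}=c;c^i$; $c^\star$ (resp. $c^\omega$) is the least (resp. greatest) fixed point of $y\mapsto\mathbf{nil}\sqcup c;y$; $c^\infty=c^\omega;\bot$. One has $c^\star=\bigsqcup_{i\in\mathbb N}c^i$ and $c^\omega=c^\star\sqcup c^\infty$. States and relations. $V$ is a countable set of variables, $S$ a set, $\Sigma$ the set of partial functions $V\rightharpoonup S$. For $W\subseteq V$, $\mathrm{id}(W)$ relates $\sigma,\sigma'\in\Sigma$ iff they agree on every variable in $W$; $\mathrm{id}(x)=\mathrm{id}(\{x\})$, $\mathrm{id}(\overline x)=\mathrm{id}(V\setminus\{x\})$, and $\mathrm{id}$ is the identity relation on $\Sigma$. For $p\subseteq\Sigma$, $\mathsf E_x p$ is the image of $p$ under $\mathrm{id}(\overline x)$. For $r\subseteq\Sigma\times\Sigma$ (with $\circ$ denoting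 left-to-right relational composition), $\mathsf E^{\mathsf{first}}_x r=\mathrm{id}(\overline x)\circ r$, $\mathsf E^{\mathsf{last}}_x r=r\circ\mathrm{id}(\overline x)$, $\mathsf E_x r=\mathrm{id}(\overline x)\circ r\circ\mathrm{id}(\overline x)$. A relation $g$ is reflexive if $\mathrm{id}\subseteq g$. Primitive commands. $\tau:\mathcal P(\Sigma)\to\mathcal C$ (tests) and $\pi,\epsilon:\mathcal P(\Sigma\times\Sigma)\to\mathcal A$ (program and environment steps) are injective homomorphisms of complete Boolean algebras onto complete Boolean sub-algebras of $\mathcal C$ (joins, and nonempty meets, computed in $\mathcal C$; complement relative to the greatest element of the sub-algebra), with $\tau(\emptyset)=\pi(\emptyset)=\epsilon(\emptyset)=\bot$ and $\tau(\Sigma)=\mathbf{nil}$. $\mathcal A\subseteq\mathcal C$ is the complete Boolean sub-algebra of atomic steps, in which $\boldsymbol\pi=\pi(\Sigma\times\Sigma)$ and $\boldsymbol\epsilon=\epsilon(\Sigma\times\Sigma)$ are complementary; $\boldsymbol\alpha=\boldsymbol\pi\sqcup\boldsymbol\epsilon$. $\mathbf{chaos}=\boldsymbol\alpha^\omega$ is the identity of $\Cap$, and $a=a\Cap(\boldsymbol\alpha;\mathbf{chaos})$ for all $a\in\mathcal A$. Localisation. For each $x\in V$ there are unary operators $\mathsf E_x,\mathsf E^{\mathsf{first}}_x,\mathsf E^{\mathsf{last}}_x$ on $\mathcal C$ (binding tighter than binary operators). Each family $F\in\{\mathsf E,\mathsf E^{\mathsf{first}},\mathsf E^{\mathsf{last}}\}$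 satisfies $c\le F_xc$; $F_x(c\sqcap F_xd)=F_xc\sqcap F_xd$; $F_xF_yc=F_yF_xc$; $F_x(\bigsqcup C)=\bigsqcup_{c\in C}F_xc$. Further axioms: $\mathsf E^{\mathsf{first}}_xc\le\mathsf E_xc$; $\mathsf E^{\mathsf{last}}_xc\le\mathsf E_xc$; $\mathsf E_x\mathsf E^{\mathsf{first}}_yc=\mathsf E^{\mathsf{first}}_y\mathsf E_xc$; $\mathsf E_x\mathsf E^{\mathsf{last}}_yc=\mathsf E^{\mathsf{last}}_y\mathsf E_xc$; $\mathsf E^{\mathsf{first}}_x\mathsf E^{\mathsf{last}}_yc=\mathsf E^{\mathsf{last}}_y\mathsf E^{\mathsf{first}}_xc$; $\mathsf E_x\tau(p)=\mathsf E^{\mathsf{first}}_x\tau(p)=\mathsf E^{\mathsf{last}}_x\tau(p)=\tau(\mathsf E_xp)$; $F_x\pi(r)=\pi(F_xr)$ and $F_x\epsilon(r)=\epsilon(F_xr)$ for each of the three $F$; $\mathsf E_x(c;\mathsf E^{\mathsf{first}}_xd)=\mathsf E_xc;\mathsf E_xd=\mathsf E_x(\mathsf E^{\mathsf{last}}_xc;d)$; if $c=c\Cap(\boldsymbol\alpha;\mathbf{chaos})$ then $\mathsf E^{\mathsf{first}}_x(c;d)=\mathsf E^{\mathsf{first}}_xc;d$ and $\mathsf E^{\mathsf{last}}_x(d;c)=d;\mathsf E^{\mathsf{last}}_xc$; $\mathsf E_x(c\Cap\mathsf E_xd)=\mathsf E_xc\Cap\mathsf E_xd$; $\mathsf E^{\mathsf{first}}_x(c\Cap\mathsf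 E^{\mathsf{first}}_xd)=\mathsf E^{\mathsf{first}}_xc\Cap\mathsf E^{\mathsf{first}}_xd$; for $a\in\mathcal A$ with $\mathsf E_xa=\mathsf E^{\mathsf{last}}_xa$, $\mathsf E_x(a^\infty)=(\mathsf E_xa)^\infty$. Derived commands. $\mathbf{guar}\,g=(\pi(g)\sqcup\boldsymbol\epsilon)^\omega$; $\mathbf{demand}\,r=(\epsilon(r)\sqcup\boldsymbol\pi)^\omega$; $\mathbf{term}=\boldsymbol\alpha^\star;\boldsymbol\epsilon^\omega$; $\mathbf{idle}=\mathbf{term}\Cap\mathbf{guar}\,\mathrm{id}$. Known properties of the algebra: $\mathbf{guar}\,g_1\Cap\mathbf{guar}\,g_2=\mathbf{guar}(g_1\cap g_2)$; $\mathbf{guar}\,g\Cap(c;d)=(\mathbf{guar}\,g\Cap c);(\mathbf{guar}\,g\Cap d)$; $\mathbf{idle}=\mathbf{idle}\Cap\mathbf{guar}\,g$ if $g$ is reflexive. Local blocks. $(\mathbf{local}\,x\cdot c)=\mathsf E_x(\mathbf{demand}\,\mathrm{id}(x)\Cap c)\Cap\mathbf{guar}\,\mathrm{id}(x)$ and $(\mathbf{var}\,x\cdot c)=\mathbf{idle};(\mathbf{local}\,x\cdot c);\mathbf{idle}$. *)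

theory Defs
  imports "HOL-Library.Countable_Set"
begin

unbundle lattice_syntax

text \<open>
  The commands are the elements of a type \<open>'c\<close> of sort
  \<open>{complete_lattice, distrib_lattice}\<close>: only finite distributivity is imposed, since the class
  \<open>complete_distrib_lattice\<close> stands for the stronger complete distributivity. The order is
  refinement with \<open>\<bottom>\<close> the least and \<open>\<top>\<close> the greatest command, so that nondeterministic choice
  is the join. The functions \<open>test\<close>, \<open>pgm\<close>, \<open>env\<close> (written \<open>\<tau>\<close>, \<open>\<pi>\<close>, \<open>\<epsilon>\<close> in the
  literature) are constrained only on subsets of the state space, and the localisation operators
  only at the variables of the algebra.
\<close>

record ('v, 's, 'c) command_structure =
  vars :: "'v set"
  vals :: "'s set"
  nil :: 'c
  seq :: "'c \<Rightarrow> 'c \<Rightarrow> 'c"  (infixr ";;\<index>" 75)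
  wconj :: "'c \<Rightarrow> 'c \<Rightarrow> 'c"  (infixl "\<^bold>\<inter>\<index>" 72)
  test :: "('v \<rightharpoonup> 's) set \<Rightarrow> 'c"
  pgm :: "('v \<rightharpoonup> 's) rel \<Rightarrow> 'c"
  env :: "('v \<rightharpoonup> 's) rel \<Rightarrow> 'c"
  atomic :: "'c set"
  Loc :: "'v \<Rightarrow> 'c \<Rightarrow> 'c"
  Loc_first :: "'v \<Rightarrow> 'c \<Rightarrow> 'c"
  Loc_last :: "'v \<Rightarrow> 'c \<Rightarrow> 'c"


section \<open>States and relations\<close>

definition states :: "('v, 's, 'c) command_structure \<Rightarrow> ('v \<rightharpoonup> 's) set" where
  "states A = {\<sigma>. dom \<sigma> \<subseteq> vars A \<and> ran \<sigma> \<subseteq> vals A}"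

definition id_vars :: "('v, 's, 'c) command_structure \<Rightarrow> 'v set \<Rightarrow> ('v \<rightharpoonup> 's) rel" where
  "id_vars A W = {(\<sigma>, \<sigma>'). \<sigma> \<in> states A \<and> \<sigma>' \<in> states A \<and> (\<forall>v\<in>W. \<sigma> v = \<sigma>' v)}"

abbreviation id_var :: "('v, 's, 'c) command_structure \<Rightarrow> 'v \<Rightarrow> ('v \<rightharpoonup> 's) rel" where
  "id_var A x \<equiv> id_vars A {x}"

abbreviation id_except :: "('v, 's, 'c) command_structure \<Rightarrow> 'v \<Rightarrow> ('v \<rightharpoonup> 's) rel" where
  "id_except A x \<equiv> id_vars A (vars A - {x})"

definition loc_set ::
    "('v, 's, 'c) command_structure \<Rightarrow> 'v \<Rightarrow> ('v \<rightharpoonup> 's) set \<Rightarrow> ('v \<rightharpoonup> 's) set" where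
  "loc_set A x p = id_except A x `` p"

definition loc_first_rel ::
    "('v, 's, 'c) command_structure \<Rightarrow> 'v \<Rightarrow> ('v \<rightharpoonup> 's) rel \<Rightarrow> ('v \<rightharpoonup> 's) rel" where
  "loc_first_rel A x r = id_except A x O r"

definition loc_last_rel ::
    "('v, 's, 'c) command_structure \<Rightarrow> 'v \<Rightarrow> ('v \<rightharpoonup> 's) rel \<Rightarrow> ('v \<rightharpoonup> 's) rel" where
  "loc_last_rel A x r = r O id_except A x"

definition loc_rel ::
    "('v, 's, 'c) command_structure \<Rightarrow> 'v \<Rightarrow> ('v \<rightharpoonup> 's) rel \<Rightarrow> ('v \<rightharpoonup> 's) rel" where
  "loc_rel A x r = id_except A x O r O id_except A x"


section \<open>Iterations and derived commands\<close>

definition iter_pow ::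
    "('v, 's, 'c::complete_lattice) command_structure \<Rightarrow> 'c \<Rightarrow> nat \<Rightarrow> 'c" where
  "iter_pow A c i = (seq A c ^^ i) (nil A)"

definition fin_iter :: "('v, 's, 'c::complete_lattice) command_structure \<Rightarrow> 'c \<Rightarrow> 'c" where
  "fin_iter A c = lfp (\<lambda>y. nil A \<squnion> c ;;\<^bsub>A\<^esub> y)"

definition omega_iter :: "('v, 's, 'c::complete_lattice) command_structure \<Rightarrow> 'c \<Rightarrow> 'c" where
  "omega_iter A c = gfp (\<lambda>y. nil A \<squnion> c ;;\<^bsub>A\<^esub> y)"

definition inf_iter :: "('v, 's, 'c::complete_lattice) command_structure \<Rightarrow> 'c \<Rightarrow> 'c" where
  "inf_iter A c = omega_iter A c ;;\<^bsub>A\<^esub> \<bottom>"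

definition pgm_step :: "('v, 's, 'c) command_structure \<Rightarrow> 'c" where
  "pgm_step A = pgm A (states A \<times> states A)"

definition env_step :: "('v, 's, 'c) command_structure \<Rightarrow> 'c" where
  "env_step A = env A (states A \<times> states A)"

definition atomic_step :: "('v, 's, 'c::complete_lattice) command_structure \<Rightarrow> 'c" where
  "atomic_step A = pgm_step A \<squnion> env_step A"

definition chaos :: "('v, 's, 'c::complete_lattice) command_structure \<Rightarrow> 'c" where
  "chaos A = omega_iter A (atomic_step A)"

definition guar ::
    "('v, 's, 'c::complete_lattice) command_structure \<Rightarrow> ('v \<rightharpoonup> 's) rel \<Rightarrow> 'c" where
  "guar A g = omega_iter A (pgm A g \<squnion> env_step A)"

definition demand ::
    "('v, 's, 'c::complete_lattice) command_structure \<Rightarrow> ('v \<rightharpoonup> 's) rel \<Rightarrow> 'c" where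
  "demand A r = omega_iter A (env A r \<squnion> pgm_step A)"

definition terminating :: "('v, 's, 'c::complete_lattice) command_structure \<Rightarrow> 'c" where
  "terminating A = fin_iter A (atomic_step A) ;;\<^bsub>A\<^esub> omega_iter A (env_step A)"

definition idle :: "('v, 's, 'c::complete_lattice) command_structure \<Rightarrow> 'c" where
  "idle A = terminating A \<^bold>\<inter>\<^bsub>A\<^esub> guar A (Id_on (states A))"

definition local_block ::
    "('v, 's, 'c::complete_lattice) command_structure \<Rightarrow> 'v \<Rightarrow> 'c \<Rightarrow> 'c" where
  "local_block A x c =
     Loc A x (demand A (id_var A x) \<^bold>\<inter>\<^bsub>A\<^esub> c) \<^bold>\<inter>\<^bsub>A\<^esub> guar A (id_var A x)"

definition var_block ::
    "('v, 's, 'c::complete_lattice) command_structure \<Rightarrow> 'v \<Rightarrow> 'c \<Rightarrow> 'c" where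
  "var_block A x c = idle A ;;\<^bsub>A\<^esub> local_block A x c ;;\<^bsub>A\<^esub> idle A"


section \<open>Axioms\<close>

text \<open>
  Joins (the empty one included) and nonempty meets are those of the ambient lattice, while
  complements are relative to the greatest element \<open>\<Squnion>B\<close> of the sub-algebra, which need
  not be \<open>\<top>\<close>.
\<close>

definition complete_boolean_subalgebra :: "'c::{complete_lattice, distrib_lattice} set \<Rightarrow> bool" where
  "complete_boolean_subalgebra B \<longleftrightarrow>
     (\<forall>X\<subseteq>B. \<Squnion>X \<in> B) \<and>
     (\<forall>X\<subseteq>B. X \<noteq> {} \<longrightarrow> \<Sqinter>X \<in> B) \<and>
     (\<forall>a\<in>B. \<exists>b\<in>B. a \<squnion> b = \<Squnion>B \<and> a \<sqinter> b = \<bottom>)"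

definition boolean_embedding ::
    "'u set \<Rightarrow> ('u set \<Rightarrow> 'c::{complete_lattice, distrib_lattice}) \<Rightarrow> bool" where
  "boolean_embedding U h \<longleftrightarrow>
     inj_on h (Pow U) \<and>
     complete_boolean_subalgebra (h ` Pow U) \<and>
     (\<forall>P\<subseteq>Pow U. h (\<Union>P) = \<Squnion>(h ` P)) \<and>
     (\<forall>P\<subseteq>Pow U. P \<noteq> {} \<longrightarrow> h (\<Inter>P) = \<Sqinter>(h ` P)) \<and>
     (\<forall>p\<subseteq>U. h p \<squnion> h (U - p) = h U \<and> h p \<sqinter> h (U - p) = \<bottom>)"

text \<open>
  The laws \<open>fin_iter_eq_Sup\<close>, \<open>omega_iter_eq\<close>, \<open>guar_wconj_guar\<close>, \<open>guar_wconj_seq\<close> and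
  \<open>idle_wconj_guar\<close> below are known properties of the full concurrent refinement algebra. They
  are assumed because the axioms from which they are usually derived (such as the interchange laws
  of weak conjunction with sequential composition) are not part of this presentation.
\<close>

locale iteration_algebra =
  fixes A :: "('v, 's, 'c::{complete_lattice, distrib_lattice}) command_structure" (structure)
  assumes countable_vars: "countable (vars A)"
    and seq_assoc: "(c ;; d) ;; e = c ;; (d ;; e)"
    and nil_seq: "nil A ;; c = c"
    and seq_nil: "c ;; nil A = c"
    and seq_mono: "c \<le> c' \<Longrightarrow> d \<le> d' \<Longrightarrow> c ;; d \<le> c' ;; d'"
    and wconj_assoc: "(c \<^bold>\<inter> d) \<^bold>\<inter> e = c \<^bold>\<inter> (d \<^bold>\<inter> e)"
    and wconj_commute: "c \<^bold>\<inter> d = d \<^bold>\<inter> c"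
    and wconj_idem: "c \<^bold>\<inter> c = c"
    and wconj_mono: "c \<le> c' \<Longrightarrow> d \<le> d' \<Longrightarrow> c \<^bold>\<inter> d \<le> c' \<^bold>\<inter> d'"
    and fin_iter_eq_Sup: "fin_iter A c = (\<Squnion>i. iter_pow A c i)"
    and omega_iter_eq: "omega_iter A c = fin_iter A c \<squnion> inf_iter A c"

locale primitive_algebra = iteration_algebra A
  for A :: "('v, 's, 'c::{complete_lattice, distrib_lattice}) command_structure" (structure) +
  assumes test_embedding: "boolean_embedding (states A) (test A)"
    and pgm_embedding: "boolean_embedding (states A \<times> states A) (pgm A)"
    and env_embedding: "boolean_embedding (states A \<times> states A) (env A)"
    and test_empty: "test A {} = \<bottom>"
    and pgm_empty: "pgm A {} = \<bottom>"
    and env_empty: "env A {} = \<bottom>"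
    and test_states: "test A (states A) = nil A"
    and atomic_subalgebra: "complete_boolean_subalgebra (atomic A)"
    and pgm_atomic: "r \<subseteq> states A \<times> states A \<Longrightarrow> pgm A r \<in> atomic A"
    and env_atomic: "r \<subseteq> states A \<times> states A \<Longrightarrow> env A r \<in> atomic A"
    and pgm_sup_env: "pgm_step A \<squnion> env_step A = \<Squnion>(atomic A)"
    and pgm_inf_env: "pgm_step A \<sqinter> env_step A = \<bottom>"
    and wconj_chaos: "c \<^bold>\<inter> chaos A = c"
    and atomic_wconj: "a \<in> atomic A \<Longrightarrow> a = a \<^bold>\<inter> (atomic_step A ;; chaos A)"
    and guar_wconj_guar:
      "g1 \<subseteq> states A \<times> states A \<Longrightarrow> g2 \<subseteq> states A \<times> states A \<Longrightarrow>
        guar A g1 \<^bold>\<inter> guar A g2 = guar A (g1 \<inter> g2)"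
    and guar_wconj_seq:
      "g \<subseteq> states A \<times> states A \<Longrightarrow>
        guar A g \<^bold>\<inter> (c ;; d) = (guar A g \<^bold>\<inter> c) ;; (guar A g \<^bold>\<inter> d)"
    and idle_wconj_guar:
      "g \<subseteq> states A \<times> states A \<Longrightarrow> refl_on (states A) g \<Longrightarrow>
        idle A = idle A \<^bold>\<inter> guar A g"

locale localisation_family =
  fixes V :: "'v set" and F :: "'v \<Rightarrow> 'c::{complete_lattice, distrib_lattice} \<Rightarrow> 'c"
  assumes increasing: "x \<in> V \<Longrightarrow> c \<le> F x c"
    and inf_closed: "x \<in> V \<Longrightarrow> F x (c \<sqinter> F x d) = F x c \<sqinter> F x d"
    and commute: "x \<in> V \<Longrightarrow> y \<in> V \<Longrightarrow> F x (F y c) = F y (F x c)"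
    and Sup_distrib: "x \<in> V \<Longrightarrow> F x (\<Squnion>C) = (\<Squnion>c\<in>C. F x c)"

locale localisation_algebra = primitive_algebra A +
  Loc: localisation_family "vars A" "Loc A" +
  Loc_first: localisation_family "vars A" "Loc_first A" +
  Loc_last: localisation_family "vars A" "Loc_last A"
  for A :: "('v, 's, 'c::{complete_lattice, distrib_lattice}) command_structure" (structure) +
  assumes Loc_first_le: "x \<in> vars A \<Longrightarrow> Loc_first A x c \<le> Loc A x c"
    and Loc_last_le: "x \<in> vars A \<Longrightarrow> Loc_last A x c \<le> Loc A x c"
    and Loc_Loc_first:
      "x \<in> vars A \<Longrightarrow> y \<in> vars A \<Longrightarrow>
        Loc A x (Loc_first A y c) = Loc_first A y (Loc A x c)"
    and Loc_Loc_last: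
      "x \<in> vars A \<Longrightarrow> y \<in> vars A \<Longrightarrow>
        Loc A x (Loc_last A y c) = Loc_last A y (Loc A x c)"
    and Loc_first_Loc_last:
      "x \<in> vars A \<Longrightarrow> y \<in> vars A \<Longrightarrow>
        Loc_first A x (Loc_last A y c) = Loc_last A y (Loc_first A x c)"
    and Loc_test:
      "x \<in> vars A \<Longrightarrow> p \<subseteq> states A \<Longrightarrow> Loc A x (test A p) = test A (loc_set A x p)"
    and Loc_first_test:
      "x \<in> vars A \<Longrightarrow> p \<subseteq> states A \<Longrightarrow> Loc_first A x (test A p) = test A (loc_set A x p)"
    and Loc_last_test:
      "x \<in> vars A \<Longrightarrow> p \<subseteq> states A \<Longrightarrow> Loc_last A x (test A p) = test A (loc_set A x p)"
    and Loc_pgm: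
      "x \<in> vars A \<Longrightarrow> r \<subseteq> states A \<times> states A \<Longrightarrow>
        Loc A x (pgm A r) = pgm A (loc_rel A x r)"
    and Loc_first_pgm:
      "x \<in> vars A \<Longrightarrow> r \<subseteq> states A \<times> states A \<Longrightarrow>
        Loc_first A x (pgm A r) = pgm A (loc_first_rel A x r)"
    and Loc_last_pgm:
      "x \<in> vars A \<Longrightarrow> r \<subseteq> states A \<times> states A \<Longrightarrow>
        Loc_last A x (pgm A r) = pgm A (loc_last_rel A x r)"
    and Loc_env:
      "x \<in> vars A \<Longrightarrow> r \<subseteq> states A \<times> states A \<Longrightarrow>
        Loc A x (env A r) = env A (loc_rel A x r)"
    and Loc_first_env:
      "x \<in> vars A \<Longrightarrow> r \<subseteq> states A \<times> states A \<Longrightarrow>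
        Loc_first A x (env A r) = env A (loc_first_rel A x r)"
    and Loc_last_env:
      "x \<in> vars A \<Longrightarrow> r \<subseteq> states A \<times> states A \<Longrightarrow>
        Loc_last A x (env A r) = env A (loc_last_rel A x r)"
    and Loc_seq_first:
      "x \<in> vars A \<Longrightarrow> Loc A x (c ;; Loc_first A x d) = Loc A x c ;; Loc A x d"
    and Loc_seq_last:
      "x \<in> vars A \<Longrightarrow> Loc A x c ;; Loc A x d = Loc A x (Loc_last A x c ;; d)"
    and Loc_first_seq:
      "x \<in> vars A \<Longrightarrow> c = c \<^bold>\<inter> (atomic_step A ;; chaos A) \<Longrightarrow>
        Loc_first A x (c ;; d) = Loc_first A x c ;; d"
    and Loc_last_seq:
      "x \<in> vars A \<Longrightarrow> c = c \<^bold>\<inter> (atomic_step A ;; chaos A) \<Longrightarrow>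
        Loc_last A x (d ;; c) = d ;; Loc_last A x c"
    and Loc_wconj:
      "x \<in> vars A \<Longrightarrow> Loc A x (c \<^bold>\<inter> Loc A x d) = Loc A x c \<^bold>\<inter> Loc A x d"
    and Loc_first_wconj:
      "x \<in> vars A \<Longrightarrow>
        Loc_first A x (c \<^bold>\<inter> Loc_first A x d) = Loc_first A x c \<^bold>\<inter> Loc_first A x d"
    and Loc_inf_iter:
      "x \<in> vars A \<Longrightarrow> a \<in> atomic A \<Longrightarrow> Loc A x a = Loc_last A x a \<Longrightarrow>
        Loc A x (inf_iter A a) = inf_iter A (Loc A x a)"

end

theory Submission
  imports Defs
begin

text \<open>
  Weak conjunction with a guarantee distributes over sequential composition and is absorbed by
  \<open>idle\<close>, so it suffices to move \<open>guar g\<close> through the localisation inside the local block.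
  For this, \<open>guar g\<close> has to be a fixed point of \<open>E\<^sub>x\<close>. It is the iteration \<open>a\<^sup>\<omega>\<close> of an atomic step
  \<open>a\<close> with \<open>E\<^sub>x a = a = E\<^sup>l\<^sup>a\<^sup>s\<^sup>t\<^sub>x a\<close>, and such an \<open>E\<^sub>x\<close> fixes each finite power of \<open>a\<close> as well as its
  infinite iteration.
\<close>

text \<open>\<open>id_except A x\<close> is an equivalence relation on the states: transitivity
  gives one inclusion, reflexivity the other.\<close>

lemma id_except_O_id_except: "id_except A x O id_except A x = id_except A x"
proof (rule equalityI)
  show "id_except A x O id_except A x \<subseteq> id_except A x"
    unfolding id_vars_def by auto
  show "id_except A x \<subseteq> id_except A x O id_except A x"
  proof (rule subrelI)
    fix \<sigma> \<sigma>' assume *: "(\<sigma>, \<sigma>') \<in> id_except A x"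
    then have "(\<sigma>, \<sigma>) \<in> id_except A x"
      by (simp add: id_vars_def)
    with * show "(\<sigma>, \<sigma>') \<in> id_except A x O id_except A x"
      by (rule relcompI[rotated])
  qed
qed

text \<open>The new trailing \<open>id_except\<close> is absorbed by the one already ending
  \<open>loc_rel\<close>. Hence fixed points of \<open>loc_rel\<close> are fixed by
  \<open>loc_last_rel\<close> too, as \<open>Loc_omega_iter\<close> will require.\<close>

lemma loc_last_rel_loc_rel: "loc_last_rel A x (loc_rel A x r) = loc_rel A x r"
  by (simp add: loc_last_rel_def loc_rel_def O_assoc id_except_O_id_except)

lemma loc_rel_states: "loc_rel A x (states A \<times> states A) = states A \<times> states A"
proof (rule equalityI)
  show "loc_rel A x (states A \<times> states A) \<subseteq> states A \<times> states A"
    by (auto simp: loc_rel_def id_vars_def)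
  have "(\<sigma>, \<sigma>) \<in> id_except A x" if "\<sigma> \<in> states A" for \<sigma>
    using that by (simp add: id_vars_def)
  then show "states A \<times> states A \<subseteq> loc_rel A x (states A \<times> states A)"
    unfolding loc_rel_def by blast
qed

lemma (in localisation_family) sup_distrib:
  assumes "x \<in> V"
  shows "F x (c \<squnion> d) = F x c \<squnion> F x d"
  using Sup_distrib[OF assms, of "{c, d}"] by simp

context localisation_algebra
begin

text \<open>\<open>nil\<close> is the test of all states, and each state is
  \<open>id_except\<close>-related to itself.\<close>

lemma Loc_nil:
  assumes "x \<in> vars A"
  shows "Loc A x (nil A) = nil A"
proof -
  have "loc_set A x (states A) = states A"
    by (auto simp: loc_set_def id_vars_def)
  then show ?thesis
    using Loc_test[OF assms, of "states A"] by (simp add: test_states)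
qed

lemma Loc_iter_pow:
  assumes "x \<in> vars A" "Loc A x a = a" "Loc_last A x a = a"
  shows "Loc A x (iter_pow A a i) = iter_pow A a i"
proof (induction i)
  case 0
  then show ?case
    by (simp add: iter_pow_def Loc_nil assms)
next
  case (Suc i)
  \<comment> \<open>As \<open>Loc_last\<close> fixes \<open>a\<close>, \<open>Loc_seq_last\<close>
    splits \<open>Loc\<close> over the composition of \<open>a\<close> with its power.\<close>
  then show ?case
    using Loc_seq_last[OF assms(1), of a "iter_pow A a i"]
    by (simp add: iter_pow_def assms)
qed

lemma Loc_omega_iter:
  assumes "x \<in> vars A" "a \<in> atomic A" "Loc A x a = a" "Loc_last A x a = a"
  shows "Loc A x (omega_iter A a) = omega_iter A a"
proof -
  have "Loc A x (fin_iter A a) = fin_iter A a"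
    using assms by (simp add: fin_iter_eq_Sup Loc.Sup_distrib Loc_iter_pow image_image)
  \<comment> \<open>Both localisations of \<open>a\<close> equal \<open>a\<close>, so the side
    condition of \<open>Loc_inf_iter\<close> holds.\<close>
  moreover have "Loc A x (inf_iter A a) = inf_iter A a"
    using Loc_inf_iter[of x a] assms by simp
  ultimately show ?thesis
    by (simp add: omega_iter_eq Loc.sup_distrib assms(1))
qed

lemma atomic_sup:
  assumes "a \<in> atomic A" "b \<in> atomic A"
  shows "a \<squnion> b \<in> atomic A"
proof -
  have "\<forall>X\<subseteq>atomic A. \<Squnion>X \<in> atomic A"
    using atomic_subalgebra by (simp add: complete_boolean_subalgebra_def)
  moreover have "{a, b} \<subseteq> atomic A"
    using assms by simp
  ultimately have "\<Squnion>{a, b} \<in> atomic A"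
    by (elim allE impE)
  then show ?thesis by simp
qed

lemma Loc_guar:
  assumes x: "x \<in> vars A" and g: "g \<subseteq> states A \<times> states A" "g = loc_rel A x g"
  shows "Loc A x (guar A g) = guar A g"
  unfolding guar_def
proof (rule Loc_omega_iter[OF x])
  show "pgm A g \<squnion> env_step A \<in> atomic A"
    unfolding env_step_def by (intro atomic_sup pgm_atomic env_atomic g(1) subset_refl)
  show "Loc A x (pgm A g \<squnion> env_step A) = pgm A g \<squnion> env_step A"
    using g(1) by (simp add: Loc.sup_distrib x env_step_def Loc_pgm Loc_env loc_rel_states
        flip: g(2))
  have "loc_last_rel A x g = g"
    using loc_last_rel_loc_rel[of A x g] by (simp flip: g(2))
  moreover have "loc_last_rel A x (states A \<times> states A) = states A \<times> states A"
    using loc_last_rel_loc_rel[of A x "states A \<times> states A"] by (simp add: loc_rel_states)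
  ultimately show "Loc_last A x (pgm A g \<squnion> env_step A) = pgm A g \<squnion> env_step A"
    using g(1) by (simp add: Loc_last.sup_distrib x env_step_def Loc_last_pgm Loc_last_env)
qed

lemma local_block_wconj_guar:
  assumes x: "x \<in> vars A" and g: "g \<subseteq> states A \<times> states A" "g = loc_rel A x g"
  shows "local_block A x c \<^bold>\<inter> guar A g = local_block A x (c \<^bold>\<inter> guar A g)"
proof -
  let ?d = "demand A (id_var A x)" and ?h = "guar A (id_var A x)"
  \<comment> \<open>Writing the guarantee as its own localisation gives it the form in which
    \<open>Loc_wconj\<close> can draw it under \<open>Loc\<close>.\<close>
  have "local_block A x c \<^bold>\<inter> guar A g
      = (Loc A x (?d \<^bold>\<inter> c) \<^bold>\<inter> Loc A x (guar A g)) \<^bold>\<inter> ?h"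
    unfolding local_block_def Loc_guar[OF assms] wconj_assoc
    by (simp add: wconj_commute)
  also have "\<dots> = Loc A x ((?d \<^bold>\<inter> c) \<^bold>\<inter> Loc A x (guar A g)) \<^bold>\<inter> ?h"
    by (simp add: Loc_wconj x)
  also have "\<dots> = local_block A x (c \<^bold>\<inter> guar A g)"
    unfolding local_block_def Loc_guar[OF assms] by (simp add: wconj_assoc)
  finally show ?thesis .
qed

end

theorem mainTheorem5:
  fixes A :: "('v, 's, 'c::{complete_lattice, distrib_lattice}) command_structure" (structure)
    and x :: 'v and c :: 'c and g :: "('v \<rightharpoonup> 's) rel"
  assumes "localisation_algebra A"
    and "x \<in> vars A"
    and "g \<subseteq> states A \<times> states A"
    and "refl_on (states A) g"
    and "g = loc_rel A x g"
  shows "var_block A x c \<^bold>\<inter> guar A g = var_block A x (c \<^bold>\<inter> guar A g)"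
proof -
  interpret localisation_algebra A by fact
  have "guar A g \<^bold>\<inter> idle A = idle A"
    using idle_wconj_guar[OF assms(3,4)] by (simp add: wconj_commute)
  \<comment> \<open>The guarantee distributes over both compositions; each \<open>idle\<close>
    absorbs its copy, leaving one on the local block.\<close>
  then have "guar A g \<^bold>\<inter> var_block A x c
      = idle A ;; (guar A g \<^bold>\<inter> local_block A x c) ;; idle A"
    by (simp add: var_block_def guar_wconj_seq[OF assms(3)])
  also have "guar A g \<^bold>\<inter> local_block A x c = local_block A x (c \<^bold>\<inter> guar A g)"
    using local_block_wconj_guar[OF assms(2,3,5)] by (simp add: wconj_commute)
  finally show ?thesis
    by (simp add: var_block_def wconj_commute)
qed

end
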